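(* Let $a,b,n$ be positive integers with $a$ odd and $b\equiv 2\pmod 4$. Then $$t(a,a,b,b;n)=N(a,a,b,b;4n+a+b).$$
   Context: For positive integers $a_1,\dots,a_k$ and a nonnegative integer $n$, $N(a_1,\dots,a_k;n)$ is the number of $(x_1,\dots,x_k)\in\mathbb Z^k$ with $n=a_1x_1^2+\cdots+a_kx_k^2$, and $t(a_1,\dots,a_k;n)$ is the number of $(x_1,\dots,x_k)\in\mathbb Z^k$ with $n=a_1\frac{x_1(x_1-1)}2+\cdots+a_k\frac{x_k(x_k-1)}2$. *)

theory Defs
  imports Complex_Main "HOL-Number_Theory.Cong"
begin

text \<open>
  The coefficients \<open>a\<^sub>1, \<dots>, a\<^sub>k\<close> form the list \<open>as\<close>, and integer \<open>k\<close>-tuples are integer lists of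
  the same length. When all coefficients are positive the counted sets are finite, so \<open>card\<close> is
  the true number of solutions.
\<close>

definition N_rep :: "nat list \<Rightarrow> nat \<Rightarrow> nat" where
  "N_rep as n = card {xs :: int list. length xs = length as \<and>
     int n = (\<Sum>i<length as. int (as ! i) * (xs ! i)\<^sup>2)}"

text \<open>The division by 2 is exact, since \<open>x * (x - 1)\<close> is always even.\<close>

definition t_rep :: "nat list \<Rightarrow> nat \<Rightarrow> nat" where
  "t_rep as n = card {xs :: int list. length xs = length as \<and>
     int n = (\<Sum>i<length as. int (as ! i) * ((xs ! i) * (xs ! i - 1) div 2))}"

end

theory Submission
  imports Defs
begin

text \<open>
  With \<open>T x = x (x - 1) / 2\<close>, the substitution \<open>u = x + y - 1\<close>, \<open>v = x - y\<close> gives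
  \<open>u\<^sup>2 + v\<^sup>2 = 4 (T x + T y) + 1\<close> and maps \<open>\<int>\<^sup>2\<close> bijectively onto the pairs \<open>(u, v)\<close> with \<open>u + v\<close> odd.
  Applied to both pairs of variables it matches the solutions counted by \<open>t\<close> with those solutions
  \<open>(u, v, s, t)\<close> counted by \<open>N\<close> for which \<open>u + v\<close> and \<open>s + t\<close> are odd. Reducing
  \<open>4 n + a + b = a (u\<^sup>2 + v\<^sup>2) + b (s\<^sup>2 + t\<^sup>2)\<close> modulo 2 and then modulo 4 shows that every solution
  satisfies this parity condition.
\<close>

lemma sum_squares_eq_triangular:
  fixes x y :: int
  shows "(x + y - 1)\<^sup>2 + (x - y)\<^sup>2 = 4 * (x * (x - 1) div 2 + y * (y - 1) div 2) + 1"
proof -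
  have "4 * (z * (z - 1) div 2) = 2 * (z * (z - 1))" for z :: int
    using dvd_mult_div_cancel[of 2 "z * (z - 1)"] by simp
  from this[of x] this[of y] show ?thesis
    by (simp add: power2_eq_square algebra_simps)
qed

lemma odd_sum_squares_mod_4:
  fixes u v :: int
  assumes "odd (u + v)"
  obtains k where "u\<^sup>2 + v\<^sup>2 = 4 * k + 1"
proof -
  from assms obtain m where m: "u + v = 2 * m + 1"
    by (elim oddE)
  \<comment> \<open>This inverts the substitution: x = (u + v + 1) / 2 = m + 1 and y = (u - v + 1) /
    2 = m + 1 - v.\<close>
  then have "u = (m + 1) + (m + 1 - v) - 1" "v = (m + 1) - (m + 1 - v)"
    by simp_all
  with that show thesis
    by (metis sum_squares_eq_triangular)
qed

lemma odd_sums_of_representation: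
  fixes a b n u v s t :: int
  assumes "odd a" "[b = 2] (mod 4)"
    and eq: "4 * n + a + b = a * (u\<^sup>2 + v\<^sup>2) + b * (s\<^sup>2 + t\<^sup>2)"
  shows "odd (u + v)" "odd (s + t)"
proof -
  from assms(2) obtain c where b: "b = 4 * c + 2"
    by (metis cong_iff_lin cong_sym add.commute)
  have "odd (4 * n + a + b)"
    using b assms(1) by simp
  then have "odd (a * (u\<^sup>2 + v\<^sup>2) + b * (s\<^sup>2 + t\<^sup>2))"
    unfolding eq .
  then show uv: "odd (u + v)"
    using b by simp
  then obtain k where k: "u\<^sup>2 + v\<^sup>2 = 4 * k + 1"
    by (rule odd_sum_squares_mod_4)
  show "odd (s + t)"
  proof
    assume "even (s + t)"
    then have "even (s\<^sup>2 + t\<^sup>2)"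
      by simp
    then obtain j where j: "s\<^sup>2 + t\<^sup>2 = 2 * j"
      by (elim evenE)
    \<comment> \<open>Modulo 4 the terms in \<open>a\<close> cancel and b (s^2 + t^2) vanishes,
      being a product of two even numbers; what remains is b = 0, against b = 2.\<close>
    have "2 = 4 * (a * k + 2 * c * j + j - n - c)"
      using eq unfolding k j b by (simp add: algebra_simps)
    then show False
      by presburger
  qed
qed

lemma length_4_conv: "length xs = 4 \<longleftrightarrow> (\<exists>x y z w. xs = [x, y, z, w])"
  by (auto simp: numeral_eq_Suc length_Suc_conv)

theorem theorem5p12:
  fixes a b n :: nat
  assumes "a > 0" and "b > 0" and "n > 0"
    and "odd a" and "[b = 2] (mod 4)"
  shows "t_rep [a, a, b, b] n = N_rep [a, a, b, b] (4 * n + a + b)"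
proof -
  define A where "A = {xs :: int list. length xs = 4 \<and>
    int n = (\<Sum>i<4. int ([a, a, b, b] ! i) * (xs ! i * (xs ! i - 1) div 2))}"
  define B where "B = {xs :: int list. length xs = 4 \<and>
    int (4 * n + a + b) = (\<Sum>i<4. int ([a, a, b, b] ! i) * (xs ! i)\<^sup>2)}"
  define f where "f = (\<lambda>xs :: int list.
    [xs ! 0 + xs ! 1 - 1, xs ! 0 - xs ! 1, xs ! 2 + xs ! 3 - 1, xs ! 2 - xs ! 3])"
  \<comment> \<open>Solves u = x + y - 1, v = x - y for x and y; the halves are exact only if u + v
    is odd, and likewise for the second pair.\<close>
  define g where "g = (\<lambda>xs :: int list.
    [(xs ! 0 + xs ! 1 + 1) div 2, (xs ! 0 - xs ! 1 + 1) div 2,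
     (xs ! 2 + xs ! 3 + 1) div 2, (xs ! 2 - xs ! 3 + 1) div 2])"
  have A: "[x, y, z, w] \<in> A \<longleftrightarrow>
      int n = int a * (x * (x - 1) div 2 + y * (y - 1) div 2)
            + int b * (z * (z - 1) div 2 + w * (w - 1) div 2)" for x y z w
    by (simp add: A_def numeral_eq_Suc distrib_left add.assoc)
  have B: "[u, v, s, t] \<in> B \<longleftrightarrow>
      4 * int n + int a + int b = int a * (u\<^sup>2 + v\<^sup>2) + int b * (s\<^sup>2 + t\<^sup>2)" for u v s t
    by (simp add: B_def eval_nat_numeral distrib_left add.assoc)
  have f: "f [x, y, z, w] = [x + y - 1, x - y, z + w - 1, z - w]" for x y z w
    by (simp add: f_def)
  \<comment> \<open>Under \<open>f\<close> the equation of \<open>B\<close> is 4 times that of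
    \<open>A\<close>, with a + b added to both sides.\<close>
  have fAB: "f [x, y, z, w] \<in> B \<longleftrightarrow> [x, y, z, w] \<in> A" for x y z w
    unfolding A B f sum_squares_eq_triangular by (auto simp: algebra_simps)
  have gf: "g (f [x, y, z, w]) = [x, y, z, w]" for x y z w
    by (simp add: f_def g_def)
  have fg: "f (g [u, v, s, t]) = [u, v, s, t]" if "[u, v, s, t] \<in> B" for u v s t
  proof -
    have "odd (int a)" "[int b = 2] (mod 4)"
      using assms(4,5) cong_int_iff[of b 2 4] by simp_all
    note odd = odd_sums_of_representation[OF this that[unfolded B]]
    have "(u + v + 1) div 2 + (u - v + 1) div 2 - 1 = u" "(u + v + 1) div 2 - (u - v + 1) div 2 = v"
      if "odd (u + v)" for u v :: int
      using that by presburger+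
    with odd show ?thesis
      by (simp add: f_def g_def)
  qed
  have A_cases: "\<exists>x y z w. xs = [x, y, z, w]" if "xs \<in> A" for xs
    using that by (simp add: A_def length_4_conv)
  have B_cases: "\<exists>x y z w. xs = [x, y, z, w]" if "xs \<in> B" for xs
    using that by (simp add: B_def length_4_conv)
  have "bij_betw f A B"
  proof (rule bij_betw_byWitness[where f' = g])
    show "\<forall>xs\<in>A. g (f xs) = xs" "f ` A \<subseteq> B"
      using A_cases gf fAB by (metis, blast)
    show "\<forall>xs\<in>B. f (g xs) = xs"
      using B_cases fg by metis
    have "\<exists>x y z w. g xs = [x, y, z, w]" for xs
      by (simp add: g_def)
    \<comment> \<open>Since f (g xs) = xs lies in \<open>B\<close>, \<open>fAB\<close> read from
      left to right puts g xs in \<open>A\<close>, without computing triangular numbers of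
      halves.\<close>
    then show "g ` B \<subseteq> A"
      using B_cases fg fAB by (metis image_subsetI)
  qed
  then have "card A = card B"
    by (rule bij_betw_same_card)
  moreover have "length [a, a, b, b] = 4"
    by simp
  ultimately show ?thesis
    unfolding t_rep_def N_rep_def A_def B_def by (simp only:)
qed

end
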